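(* Let $\mathcal V\subset\mathbb R^2$ be open and $I\subset\mathbb R$ an open interval. Let $A,B:\mathcal V\to\mathbb R$ and $F:I\to\mathbb R$ be continuous functions such that: (1) $F$ is Lipschitz continuous; (2) there exist sequences $A^{(k)},B^{(k)}$ of $C^1$ functions on $\mathcal V$ such that, in the $C^0$ topology, $A^{(k)}\to A$, $B^{(k)}\to B$, and $\frac{\partial A^{(k)}}{\partial y}-\frac{\partial B^{(k)}}{\partial x}\to0$ as $k\to\infty$. Then the Pfaff system $$\frac{\partial f}{\partial x}(x,y)=A(x,y)\,F(f(x,y)),\qquad \frac{\partial f}{\partial y}(x,y)=B(x,y)\,F(f(x,y))$$ is uniquely integrable at every point $(x_0,y_0,z_0)\in\mathcal V\times I$.
   Context: The system $\frac{\partial f}{\partial x}=a(x,y,f)$, $\frac{\partial f}{\partial y}=b(x,y,f)$, with $a,b$ scalar functions on $\mathcal V\times I\subset\mathbb R^3$, is called uniquely integrable at $(x_0,y_0,z_0)$ if there exists a solution $f=f(x,y)$, defined in a neighbourhood of $(x_0,y_0)$, with initial condition $f(x_0,y_0)=z_0$, and this solution is unique (any two such solutions coincide near $(x_0,y_0)$). *)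

theory Defs
  imports "HOL-Analysis.Analysis"
begin

definition partial_x :: "(real \<times> real \<Rightarrow> real) \<Rightarrow> real \<times> real \<Rightarrow> real" where
  "partial_x f p = deriv (\<lambda>x. f (x, snd p)) (fst p)"

definition partial_y :: "(real \<times> real \<Rightarrow> real) \<Rightarrow> real \<times> real \<Rightarrow> real" where
  "partial_y f p = deriv (\<lambda>y. f (fst p, y)) (snd p)"

definition C1_on :: "(real \<times> real) set \<Rightarrow> (real \<times> real \<Rightarrow> real) \<Rightarrow> bool" where
  "C1_on U f \<longleftrightarrow>
     (\<exists>f' :: real \<times> real \<Rightarrow> (real \<times> real) \<Rightarrow>\<^sub>L real.
        (\<forall>p\<in>U. (f has_derivative blinfun_apply (f' p)) (at p)) \<and> continuous_on U f')"

text \<open>Convergence in the \<open>C\<^sup>0\<close> topology on a (non-compact) open set: uniform convergence on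
  compact subsets.\<close>

definition C0_converges :: "(real \<times> real) set \<Rightarrow> (nat \<Rightarrow> real \<times> real \<Rightarrow> real)
    \<Rightarrow> (real \<times> real \<Rightarrow> real) \<Rightarrow> bool" where
  "C0_converges V G g \<longleftrightarrow> (\<forall>K. compact K \<and> K \<subseteq> V \<longrightarrow> uniform_limit K G g sequentially)"

text \<open>A solution is a differentiable function; this guarantees that the values of
  \<^const>\<open>deriv\<close> below are genuine partial derivatives. If \<open>a\<close> and \<open>b\<close> are continuous,
  solutions are automatically \<open>C\<^sup>1\<close>. The right-hand sides are only meaningful on
  \<open>V \<times> I\<close>, so the graph of a solution has to lie in that set.\<close>

definition pfaff_solution :: "(real \<times> real) set \<Rightarrow> real set
    \<Rightarrow> (real \<Rightarrow> real \<Rightarrow> real \<Rightarrow> real) \<Rightarrow> (real \<Rightarrow> real \<Rightarrow> real \<Rightarrow> real)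
    \<Rightarrow> (real \<times> real) set \<Rightarrow> (real \<times> real \<Rightarrow> real) \<Rightarrow> bool" where
  "pfaff_solution V I a b U f \<longleftrightarrow>
     open U \<and> U \<subseteq> V \<and> f ` U \<subseteq> I \<and> f differentiable_on U \<and>
     (\<forall>x y. (x, y) \<in> U \<longrightarrow>
        partial_x f (x, y) = a x y (f (x, y)) \<and>
        partial_y f (x, y) = b x y (f (x, y)))"

definition uniquely_integrable_at :: "(real \<times> real) set \<Rightarrow> real set
    \<Rightarrow> (real \<Rightarrow> real \<Rightarrow> real \<Rightarrow> real) \<Rightarrow> (real \<Rightarrow> real \<Rightarrow> real \<Rightarrow> real)
    \<Rightarrow> real \<Rightarrow> real \<Rightarrow> real \<Rightarrow> bool" where
  "uniquely_integrable_at V I a b x0 y0 z0 \<longleftrightarrow>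
     (\<exists>U f. pfaff_solution V I a b U f \<and> (x0, y0) \<in> U \<and> f (x0, y0) = z0) \<and>
     (\<forall>U f U' g.
        pfaff_solution V I a b U f \<and> (x0, y0) \<in> U \<and> f (x0, y0) = z0 \<and>
        pfaff_solution V I a b U' g \<and> (x0, y0) \<in> U' \<and> g (x0, y0) = z0 \<longrightarrow>
        (\<forall>\<^sub>F p in nhds (x0, y0). f p = g p))"

end

theory Submission
  imports Defs
begin

text \<open>
  The right-hand side of the system is the one-form \<open>A dx + B dy\<close> multiplied by \<open>F(f)\<close>, so the
  variables separate: formally \<open>df / F(f) = A dx + B dy\<close>. A solution is obtained by composing a
  potential \<open>\<phi>\<close> of \<open>A dx + B dy\<close> with a solution \<open>h\<close> of the scalar equation \<open>h' = F(h)\<close>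
  (lemma \<open>separable_pfaff_local_solution\<close>).

  The form is only continuous, so the condition that it is closed has no direct meaning. It is
  replaced by the vanishing of the integral along the boundary of every rectangle contained in
  \<open>V\<close>. For the \<open>C\<^sup>1\<close> approximations this boundary integral equals, up to sign, the double integral
  of \<open>\<partial>A\<^sup>(\<^sup>k\<^sup>)/\<partial>y - \<partial>B\<^sup>(\<^sup>k\<^sup>)/\<partial>x\<close> by Green's formula, which tends to \<open>0\<close>, while the boundary
  integrals converge to that of the limit form (lemma \<open>weakly_closed_rectangle\<close>). Integrating along
  horizontal and vertical segments then yields a differentiable potential on a box around the given
  point (lemma \<open>potential_of_closed_form\<close>).

  Uniqueness comes from the Lipschitz condition on \<open>F\<close>: restricted to a segment from the initial
  point, the difference of two solutions satisfies \<open>\<bar>u'\<bar> \<le> C \<bar>u\<bar>\<close> and starts at \<open>0\<close>, hence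
  vanishes (lemma \<open>pfaff_solutions_agree\<close>).
\<close>


section \<open>Partial derivatives and differentials\<close>

lemma has_derivative_imp_partials:
  fixes f :: "real \<times> real \<Rightarrow> real"
  assumes "(f has_derivative D) (at (x, y))"
  shows "((\<lambda>t. f (t, y)) has_real_derivative D (1, 0)) (at x)"
    and "((\<lambda>s. f (x, s)) has_real_derivative D (0, 1)) (at y)"
    and "partial_x f (x, y) = D (1, 0)" and "partial_y f (x, y) = D (0, 1)"
    and "D (u, v) = D (1, 0) * u + D (0, 1) * v"
proof -
  interpret D: bounded_linear D
    using assms by (rule has_derivative_bounded_linear)
  have Dx: "D (h, 0) = D (1, 0) * h" for h
    using D.scaleR[of h "(1, 0)"] by (simp add: mult.commute)
  have Dy: "D (0, h) = D (0, 1) * h" for h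
    using D.scaleR[of h "(0, 1)"] by (simp add: mult.commute)
  have "((\<lambda>t. (t, y)) has_derivative (\<lambda>h. (h, 0))) (at x)"
    by (auto intro!: derivative_eq_intros)
  from has_derivative_compose[OF this assms]
  show X: "((\<lambda>t. f (t, y)) has_real_derivative D (1, 0)) (at x)"
    unfolding has_field_derivative_def by (rule has_derivative_eq_rhs) (rule ext, rule Dx)
  have "((\<lambda>s. (x, s)) has_derivative (\<lambda>h. (0, h))) (at y)"
    by (auto intro!: derivative_eq_intros)
  from has_derivative_compose[OF this assms]
  show Y: "((\<lambda>s. f (x, s)) has_real_derivative D (0, 1)) (at y)"
    unfolding has_field_derivative_def by (rule has_derivative_eq_rhs) (rule ext, rule Dy)
  show "partial_x f (x, y) = D (1, 0)" "partial_y f (x, y) = D (0, 1)"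
    using X Y by (simp_all add: partial_x_def partial_y_def DERIV_imp_deriv)
  show "D (u, v) = D (1, 0) * u + D (0, 1) * v"
    using D.add[of "(u, 0)" "(0, v)"] by (simp add: Dx[of u] Dy[of v])
qed

lemma C1_on_partials:
  assumes "C1_on U f"
  shows "(x, y) \<in> U \<Longrightarrow> ((\<lambda>t. f (t, y)) has_real_derivative partial_x f (x, y)) (at x)"
    and "(x, y) \<in> U \<Longrightarrow> ((\<lambda>s. f (x, s)) has_real_derivative partial_y f (x, y)) (at y)"
    and "continuous_on U (partial_x f)" and "continuous_on U (partial_y f)"
    and "continuous_on U f"
proof -
  obtain f' :: "real \<times> real \<Rightarrow> (real \<times> real) \<Rightarrow>\<^sub>L real"
    where f': "\<And>p. p \<in> U \<Longrightarrow> (f has_derivative blinfun_apply (f' p)) (at p)"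
      and cont: "continuous_on U f'"
    using assms unfolding C1_on_def by blast
  have partials: "partial_x f p = f' p (1, 0)" "partial_y f p = f' p (0, 1)" if "p \<in> U" for p
    using has_derivative_imp_partials(3,4)[of f "blinfun_apply (f' p)" "fst p" "snd p"] f'[OF that]
    by simp_all
  show "((\<lambda>t. f (t, y)) has_real_derivative partial_x f (x, y)) (at x)" if "(x, y) \<in> U"
    using has_derivative_imp_partials(1)[OF f'[OF that]] partials(1)[OF that] by simp
  show "((\<lambda>s. f (x, s)) has_real_derivative partial_y f (x, y)) (at y)" if "(x, y) \<in> U"
    using has_derivative_imp_partials(2)[OF f'[OF that]] partials(2)[OF that] by simp
  have "continuous_on U (\<lambda>p. f' p (1, 0))" "continuous_on U (\<lambda>p. f' p (0, 1))"
    by (intro continuous_intros cont)+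
  then show "continuous_on U (partial_x f)" "continuous_on U (partial_y f)"
    by (simp_all add: partials cong: continuous_on_cong)
  show "continuous_on U f"
    using f' has_derivative_continuous continuous_at_imp_continuous_on by blast
qed

section \<open>Weakly closed forms on rectangles\<close>

lemma continuous_on_slices:
  fixes g :: "real \<times> real \<Rightarrow> real"
  assumes "continuous_on (cbox (a, c) (b, d)) g"
  shows "y \<in> {c..d} \<Longrightarrow> continuous_on {a..b} (\<lambda>t. g (t, y))"
    and "x \<in> {a..b} \<Longrightarrow> continuous_on {c..d} (\<lambda>s. g (x, s))"
  by (auto intro!: continuous_intros continuous_on_compose2[OF assms])

text \<open>Green's formula for a rectangle: the double integral of each partial derivative is evaluated by
  the fundamental theorem of calculus in the matching variable, with Fubini's theorem bringing that
  variable innermost.\<close>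
lemma green_rectangle:
  fixes P Q :: "real \<times> real \<Rightarrow> real"
  assumes P: "C1_on U P" and Q: "C1_on U Q" and sub: "cbox (a, c) (b, d) \<subseteq> U"
    and ab: "a \<le> b" and cd: "c \<le> d"
  shows "integral (cbox (a, c) (b, d)) (\<lambda>p. partial_y P p - partial_x Q p) =
    (integral {a..b} (\<lambda>t. P (t, d)) - integral {a..b} (\<lambda>t. P (t, c)))
    - (integral {c..d} (\<lambda>s. Q (b, s)) - integral {c..d} (\<lambda>s. Q (a, s)))"
proof -
  let ?R = "cbox (a, c) (b, d)"
  have inU: "(t, s) \<in> U" if "t \<in> {a..b}" "s \<in> {c..d}" for t s
    using that sub by (auto simp: cbox_Pair_eq)
  note cont = C1_on_partials(3-5)[OF P, THEN continuous_on_subset[OF _ sub]]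
    C1_on_partials(3-5)[OF Q, THEN continuous_on_subset[OF _ sub]]
  note slice = cont(3)[THEN continuous_on_slices(1)] cont(6)[THEN continuous_on_slices(2)]
  have "integral ?R (partial_y P) = integral {a..b} (\<lambda>t. integral {c..d} (\<lambda>s. partial_y P (t, s)))"
    using integral_prod_continuous[OF cont(2)] by simp
  also have "\<dots> = integral {a..b} (\<lambda>t. P (t, d) - P (t, c))"
  proof (rule integral_cong)
    fix t assume t: "t \<in> {a..b}"
    have "((\<lambda>s. partial_y P (t, s)) has_integral (P (t, d) - P (t, c))) {c..d}"
      by (rule fundamental_theorem_of_calculus[OF cd])
        (use C1_on_partials(2)[OF P] inU[OF t] in
          \<open>auto intro: has_field_derivative_at_within
             simp flip: has_real_derivative_iff_has_vector_derivative\<close>)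
    then show "integral {c..d} (\<lambda>s. partial_y P (t, s)) = P (t, d) - P (t, c)"
      by (rule integral_unique)
  qed
  also have "\<dots> = integral {a..b} (\<lambda>t. P (t, d)) - integral {a..b} (\<lambda>t. P (t, c))"
    using cd by (intro integral_diff integrable_continuous_interval slice) auto
  finally have 1: "integral ?R (partial_y P) =
    integral {a..b} (\<lambda>t. P (t, d)) - integral {a..b} (\<lambda>t. P (t, c))" .
  have "integral ?R (partial_x Q) = integral {a..b} (\<lambda>t. integral {c..d} (\<lambda>s. partial_x Q (t, s)))"
    using integral_prod_continuous[OF cont(4)] by simp
  also have "\<dots> = integral {c..d} (\<lambda>s. integral {a..b} (\<lambda>t. partial_x Q (t, s)))"
    using integral_swap_continuous[of a c b d "\<lambda>t s. partial_x Q (t, s)"] cont(4) by simp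
  also have "\<dots> = integral {c..d} (\<lambda>s. Q (b, s) - Q (a, s))"
  proof (rule integral_cong)
    fix s assume s: "s \<in> {c..d}"
    have "((\<lambda>t. partial_x Q (t, s)) has_integral (Q (b, s) - Q (a, s))) {a..b}"
      by (rule fundamental_theorem_of_calculus[OF ab])
        (use C1_on_partials(1)[OF Q] inU[OF _ s] in
          \<open>auto intro: has_field_derivative_at_within
             simp flip: has_real_derivative_iff_has_vector_derivative\<close>)
    then show "integral {a..b} (\<lambda>t. partial_x Q (t, s)) = Q (b, s) - Q (a, s)"
      by (rule integral_unique)
  qed
  also have "\<dots> = integral {c..d} (\<lambda>s. Q (b, s)) - integral {c..d} (\<lambda>s. Q (a, s))"
    using ab by (intro integral_diff integrable_continuous_interval slice) auto
  finally have 2: "integral ?R (partial_x Q) =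
    integral {c..d} (\<lambda>s. Q (b, s)) - integral {c..d} (\<lambda>s. Q (a, s))" .
  show ?thesis
    unfolding 1[symmetric] 2[symmetric]
    by (intro integral_diff integrable_continuous cont)
qed

lemma uniform_limit_integral_tendsto:
  fixes f :: "nat \<Rightarrow> 'b::euclidean_space \<Rightarrow> 'c::banach"
  assumes "uniform_limit (cbox a b) f g sequentially" "\<And>n. continuous_on (cbox a b) (f n)"
  shows "(\<lambda>n. integral (cbox a b) (f n)) \<longlonglongrightarrow> integral (cbox a b) g"
proof -
  obtain I J where "\<And>n. (f n has_integral I n) (cbox a b)" "(g has_integral J) (cbox a b)"
    "I \<longlonglongrightarrow> J"
    using uniform_limit_integral_cbox[OF assms] by auto
  moreover from this have "integral (cbox a b) (f n) = I n" "integral (cbox a b) g = J" for n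
    by blast+
  ultimately show ?thesis by simp
qed

lemma uniform_limit_slices:
  fixes a b c d :: real
  assumes "uniform_limit (cbox (a, c) (b, d)) G g F"
  shows "y \<in> {c..d} \<Longrightarrow> uniform_limit {a..b} (\<lambda>k t. G k (t, y)) (\<lambda>t. g (t, y)) F"
    and "x \<in> {a..b} \<Longrightarrow> uniform_limit {c..d} (\<lambda>k s. G k (x, s)) (\<lambda>s. g (x, s)) F"
  by (rule uniform_limit_compose'[OF assms], auto simp: cbox_Pair_eq)+

text \<open>Green's formula turns the hypothesis on the derivatives of the approximations into a statement
  about line integrals of the approximations themselves, and these depend continuously on the form
  in the \<open>C\<^sup>0\<close> topology. Hence the limit form has the same integral along the two monotone
  staircases from the lower left to the upper right corner.\<close>
lemma weakly_closed_rectangle: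
  assumes Ak: "\<And>k. C1_on V (Ak k)" and Bk: "\<And>k. C1_on V (Bk k)"
    and limA: "C0_converges V Ak A" and limB: "C0_converges V Bk B"
    and lim0: "C0_converges V (\<lambda>k p. partial_y (Ak k) p - partial_x (Bk k) p) (\<lambda>p. 0)"
    and sub: "cbox (a, c) (b, d) \<subseteq> V" and ab: "a \<le> b" and cd: "c \<le> d"
  shows "integral {a..b} (\<lambda>t. A (t, d)) + integral {c..d} (\<lambda>s. B (a, s)) =
    integral {a..b} (\<lambda>t. A (t, c)) + integral {c..d} (\<lambda>s. B (b, s))"
proof -
  note lims = limA limB lim0
  note lim = lims[unfolded C0_converges_def, rule_format, OF conjI[OF compact_cbox sub]]
  note cont = C1_on_partials(3-5)[OF Ak, THEN continuous_on_subset[OF _ sub]]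
    C1_on_partials(3-5)[OF Bk, THEN continuous_on_subset[OF _ sub]]
  have A: "(\<lambda>k. integral {a..b} (\<lambda>t. Ak k (t, y))) \<longlonglongrightarrow> integral {a..b} (\<lambda>t. A (t, y))"
    if "y \<in> {c..d}" for y
    using uniform_limit_integral_tendsto[where a = a and b = b, unfolded box_real]
      uniform_limit_slices(1)[OF lim(1) that] continuous_on_slices(1)[OF cont(3) that] by blast
  have B: "(\<lambda>k. integral {c..d} (\<lambda>s. Bk k (x, s))) \<longlonglongrightarrow> integral {c..d} (\<lambda>s. B (x, s))"
    if "x \<in> {a..b}" for x
    using uniform_limit_integral_tendsto[where a = c and b = d, unfolded box_real]
      uniform_limit_slices(2)[OF lim(2) that] continuous_on_slices(2)[OF cont(6) that] by blast
  have "(\<lambda>k. integral (cbox (a, c) (b, d)) (\<lambda>p. partial_y (Ak k) p - partial_x (Bk k) p)) \<longlonglongrightarrow>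
      integral (cbox (a, c) (b, d)) (\<lambda>p. 0 :: real)"
    by (intro uniform_limit_integral_tendsto lim(3) continuous_intros cont)
  moreover have "(\<lambda>k. integral (cbox (a, c) (b, d)) (\<lambda>p. partial_y (Ak k) p - partial_x (Bk k) p)) \<longlonglongrightarrow>
      (integral {a..b} (\<lambda>t. A (t, d)) - integral {a..b} (\<lambda>t. A (t, c)))
      - (integral {c..d} (\<lambda>s. B (b, s)) - integral {c..d} (\<lambda>s. B (a, s)))"
    unfolding green_rectangle[OF Ak Bk sub ab cd]
    using ab cd by (intro tendsto_intros A B) auto
  ultimately show ?thesis
    using LIMSEQ_unique by fastforce
qed

text \<open>The potential at \<open>(x, y)\<close> is the integral of the form along either staircase from the corner
  \<open>(a, c)\<close>. The staircase with vertical last step shows that the \<open>y\<close>-derivative is \<open>B\<close>, the one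
  with horizontal last step that the \<open>x\<close>-derivative is \<open>A\<close>. Starting the staircases at
  the corner of the box, not at the initial point, keeps the endpoints of every interval of
  integration in increasing order; an integral over \<open>{c..y}\<close> with \<open>y < c\<close> would be \<open>0\<close>.\<close>
lemma potential_of_closed_form:
  fixes A B :: "real \<times> real \<Rightarrow> real"
  assumes A: "continuous_on (cbox (a, c) (b, d)) A" and B: "continuous_on (cbox (a, c) (b, d)) B"
    and closed: "\<And>x y. x \<in> {a..b} \<Longrightarrow> y \<in> {c..d} \<Longrightarrow>
      integral {a..x} (\<lambda>t. A (t, y)) + integral {c..y} (\<lambda>s. B (a, s)) =
      integral {a..x} (\<lambda>t. A (t, c)) + integral {c..y} (\<lambda>s. B (x, s))"
  obtains \<phi> where "\<And>x y. (x, y) \<in> box (a, c) (b, d) \<Longrightarrow>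
    (\<phi> has_derivative (\<lambda>(u, v). A (x, y) * u + B (x, y) * v)) (at (x, y))"
proof
  define \<phi> where "\<phi> = (\<lambda>(x, y). integral {a..x} (\<lambda>t. A (t, c)) + integral {c..y} (\<lambda>s. B (x, s)))"
  fix x y assume xy: "(x, y) \<in> box (a, c) (b, d)"
  then have x: "x \<in> {a..b}" and y: "y \<in> {c..d}" 
    by (auto simp: box_def Basis_prod_def)
  \<comment> \<open>Differentiating within the closed box makes the one-sided derivatives of the integrals
    directly usable; the restriction is lifted at the end because \<open>(x, y)\<close> is interior.\<close>
  have R: "{a..b} \<times> {c..d} = cbox (a, c) (b, d)"
    by (simp add: cbox_Pair_eq)
  have "((\<lambda>x. integral {a..x} (\<lambda>t. A (t, y)) + integral {c..y} (\<lambda>s. B (a, s)))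
      has_real_derivative A (x, y)) (at x within {a..b})"
    using integral_has_real_derivative[OF continuous_on_slices(1)[OF A y] x]
    by (auto intro!: derivative_eq_intros)
  then have dx: "((\<lambda>x. \<phi> (x, y)) has_derivative (*) (A (x, y))) (at x within {a..b})"
    unfolding has_field_derivative_def
    by (rule has_derivative_transform[OF x, rotated]) (use y closed in \<open>simp add: \<phi>_def\<close>)
  have dy: "((\<lambda>y. \<phi> (x, y)) has_derivative blinfun_apply (blinfun_scaleR_left (B (x, y))))
      (at y within {c..d})" if "x \<in> {a..b}" "y \<in> {c..d}" for x y
  proof -
    have "((\<lambda>y. \<phi> (x, y)) has_real_derivative B (x, y)) (at y within {c..d})"
      unfolding \<phi>_def
      using integral_has_real_derivative[OF continuous_on_slices(2)[OF B that(1)] that(2)]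
      by (auto intro!: derivative_eq_intros)
    then show ?thesis
      unfolding has_field_derivative_def
      by (rule has_derivative_eq_rhs) (simp add: fun_eq_iff)
  qed
  have "continuous_on ({a..b} \<times> {c..d}) (\<lambda>p. blinfun_scaleR_left (B p) :: real \<Rightarrow>\<^sub>L real)"
    unfolding R by (intro bounded_linear.continuous_on[OF bounded_linear_blinfun_scaleR_left] B)
  then have "continuous (at (x, y) within {a..b} \<times> {c..d})
      (\<lambda>(x, y). blinfun_scaleR_left (B (x, y)) :: real \<Rightarrow>\<^sub>L real)"
    using x y by (auto simp: continuous_on_eq_continuous_within case_prod_unfold)
  from has_derivative_partialsI[of "\<lambda>x y. \<phi> (x, y)", OF dx dy this y]
  have "(\<phi> has_derivative (\<lambda>(u, v). A (x, y) * u + B (x, y) * v)) (at (x, y) within {a..b} \<times> {c..d})"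
    by (simp add: mult.commute)
  then show "(\<phi> has_derivative (\<lambda>(u, v). A (x, y) * u + B (x, y) * v)) (at (x, y))"
    using xy at_within_interior[of "(x, y)" "cbox (a, c) (b, d)"] unfolding R interior_cbox by simp
qed


section \<open>Scalar differential equations\<close>

text \<open>Separation of variables. A zero of \<open>F\<close> gives a constant solution. Otherwise \<open>F\<close> has no zero
  near \<open>z0\<close>, so the time \<open>G\<close> needed to travel from \<open>z0\<close> to \<open>z\<close>, an antiderivative of \<open>1 / F\<close>,
  is injective there and its inverse is a solution.\<close>
lemma autonomous_ode_local_solution:
  fixes F :: "real \<Rightarrow> real"
  assumes I: "open I" and F: "continuous_on I F" and z0: "z0 \<in> I"
  obtains \<delta> h where "\<delta> > 0" and "h 0 = z0"
    and "\<And>t. \<bar>t\<bar> < \<delta> \<Longrightarrow> h t \<in> I \<and> (h has_real_derivative F (h t)) (at t)"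
proof (cases "F z0 = 0")
  case True
  then show ?thesis
    using that[of 1 "\<lambda>_. z0"] z0 by simp
next
  case False
  have "open {z \<in> I. F z \<noteq> 0}"
    using continuous_open_preimage[OF F I, of "- {0}"] by (simp add: vimage_def Int_def open_Compl)
  then obtain e where e: "e > 0" and sub: "cball z0 e \<subseteq> {z \<in> I. F z \<noteq> 0}"
    using z0 False by (metis (mono_tags, lifting) mem_Collect_eq open_contains_cball_eq)
  define a b where "a = z0 - e" and "b = z0 + e"
  have J: "z \<in> I" "F z \<noteq> 0" if "z \<in> {a..b}" for z
    using that subsetD[OF sub, of z] by (simp_all add: a_def b_def dist_real_def abs_le_iff)
  have z0J: "z0 \<in> {a<..<b}"
    using e by (simp add: a_def b_def)
  define G where "G z = integral {a..z} (\<lambda>w. 1 / F w) - integral {a..z0} (\<lambda>w. 1 / F w)" for z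
  have "continuous_on {a..b} (\<lambda>w. 1 / F w)"
    using J by (intro continuous_intros continuous_on_subset[OF F]) auto
  then have "(G has_real_derivative 1 / F z) (at z within {a..b})" if "z \<in> {a..b}" for z
    unfolding G_def using integral_has_real_derivative that
    by (auto intro!: derivative_eq_intros)
  then have DG: "(G has_real_derivative 1 / F z) (at z)" if "z \<in> {a<..<b}" for z
    using that at_within_interior[of z "{a..b}"] by (metis greaterThanLessThan_subseteq_atLeastAtMost_iff interior_atLeastAtMost_real order_refl subsetD)
  have contG: "continuous_on {a<..<b} G"
    using DG by (meson DERIV_isCont continuous_at_imp_continuous_on)
  have inj: "inj_on G {a<..<b}"
  proof (rule linorder_inj_onI', rule notI)
    fix u v assume uv: "u \<in> {a<..<b}" "v \<in> {a<..<b}" "u < v" "G u = G v"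
    have "continuous_on {u..v} G"
      using uv by (intro continuous_on_subset[OF contG]) auto
    moreover have "(G has_derivative (*) (1 / F z)) (at z)" if "u < z" "z < v" for z
      using DG[of z] uv that by (simp add: has_field_derivative_def)
    ultimately obtain z where "u < z" "z < v" "(*) (1 / F z) = (\<lambda>v. 0)"
      using Rolle_deriv[of u v G "\<lambda>z. (*) (1 / F z)"] uv by auto
    moreover from this(3) have "1 / F z = 0"
      by (metis mult.right_neutral)
    ultimately show False
      using J(2)[of z] uv by simp
  qed
  have "open (G ` {a<..<b})"
    using injective_eq_1d_open_map_UNIV[OF contG] inj by (simp add: is_interval_oo)
  moreover have "0 \<in> G ` {a<..<b}"
    using z0J by (intro image_eqI[of _ _ z0]) (simp_all add: G_def)
  ultimately obtain \<delta> where \<delta>: "\<delta> > 0" "ball 0 \<delta> \<subseteq> G ` {a<..<b}"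
    by (meson open_contains_ball)
  define h where "h = inv_into {a<..<b} G"
  have hG: "h (G z) = z" if "z \<in> {a<..<b}" for z
    using that inj by (simp add: h_def)
  show ?thesis
  proof (rule that[OF \<delta>(1)])
    show "h 0 = z0"
      using hG[OF z0J] by (simp add: G_def)
    fix t :: real assume "\<bar>t\<bar> < \<delta>"
    then obtain z where z: "z \<in> {a<..<b}" "t = G z"
      using \<delta>(2) by (auto simp: subset_iff image_iff)
    have "(h has_derivative (*) (F z)) (at (G z))"
      by (rule has_derivative_inverse_strong[OF _ z(1) contG hG
            DG[OF z(1), unfolded has_field_derivative_def]])
        (use J(2)[of z] z(1) in \<open>auto simp: fun_eq_iff\<close>)
    then have "(h has_real_derivative F z) (at (G z))"
      by (simp add: has_field_derivative_def)
    then show "h t \<in> I \<and> (h has_real_derivative F (h t)) (at t)"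
      using J(1)[of z] z hG by simp
  qed
qed

text \<open>Since \<open>(u\<^sup>2)' = 2 u u' \<le> 2 C u\<^sup>2\<close>, the product of \<open>u\<^sup>2\<close> with the integrating factor
  \<open>exp (- 2 C t)\<close> is nonincreasing; it is nonnegative and starts at \<open>0\<close>.\<close>
lemma gronwall_zero:
  fixes u u' :: "real \<Rightarrow> real"
  assumes du: "\<And>t. t \<in> {0..1} \<Longrightarrow> (u has_real_derivative u' t) (at t)"
    and bound: "\<And>t. t \<in> {0..1} \<Longrightarrow> \<bar>u' t\<bar> \<le> C * \<bar>u t\<bar>"
    and u0: "u 0 = 0"
  shows "u 1 = 0"
proof -
  define v where "v t = (u t)\<^sup>2 * exp (- (2 * C * t))" for t
  have "v 1 \<le> v 0"
  proof (rule DERIV_nonpos_imp_nonincreasing[of 0 1 v])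
    fix t :: real assume "0 \<le> t" "t \<le> 1"
    then have t: "t \<in> {0..1}" by simp
    have "(v has_real_derivative 2 * (u t * u' t - C * (u t)\<^sup>2) * exp (- (2 * C * t))) (at t)"
      unfolding v_def
      by (rule derivative_eq_intros du[OF t] refl)+ (simp add: algebra_simps power2_eq_square)
    moreover have "u t * u' t \<le> C * (u t)\<^sup>2"
    proof -
      have "u t * u' t \<le> \<bar>u t\<bar> * \<bar>u' t\<bar>"
        by (metis abs_ge_self abs_mult)
      also have "\<dots> \<le> \<bar>u t\<bar> * (C * \<bar>u t\<bar>)"
        by (intro mult_left_mono bound t) simp
      finally show ?thesis
        by (simp add: power2_eq_square mult.assoc abs_mult_self_eq mult.left_commute)
    qed
    ultimately show "\<exists>w. (v has_real_derivative w) (at t) \<and> w \<le> 0"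
      by (metis diff_le_0_iff_le exp_ge_zero mult_nonneg_nonpos mult_nonpos_nonneg zero_le_numeral)
  qed simp
  then have "(u 1)\<^sup>2 * exp (- (2 * C)) \<le> 0"
    by (simp add: v_def u0)
  then show ?thesis
    by (simp add: mult_le_0_iff)
qed


section \<open>Existence and uniqueness for Pfaff systems\<close>

lemma pfaff_solution_has_derivative:
  assumes "pfaff_solution V I a b U f" and xy: "(x, y) \<in> U"
  shows "(f has_derivative (\<lambda>(u, v). a x y (f (x, y)) * u + b x y (f (x, y)) * v)) (at (x, y))"
proof -
  have "f differentiable (at (x, y))"
    using assms differentiable_on_eq_differentiable_at[of U f] by (simp add: pfaff_solution_def)
  then obtain D where D: "(f has_derivative D) (at (x, y))"
    by (auto simp: differentiable_def)
  have "D (u, v) = a x y (f (x, y)) * u + b x y (f (x, y)) * v" for u v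
    unfolding has_derivative_imp_partials(5)[OF D, of u v]
    using has_derivative_imp_partials(3,4)[OF D] assms by (simp add: pfaff_solution_def)
  then have "D = (\<lambda>(u, v). a x y (f (x, y)) * u + b x y (f (x, y)) * v)"
    by auto
  with D show ?thesis by simp
qed

text \<open>Along the segment from \<open>p0\<close> to \<open>p\<close>, both solutions satisfy the same ordinary differential
  equation, whose right-hand side is Lipschitz in the unknown; their difference \<open>u\<close> therefore
  satisfies a Gronwall inequality.\<close>
lemma pfaff_solutions_agree:
  assumes f: "pfaff_solution V I a b U f" and g: "pfaff_solution V I a b U' g"
    and S: "convex S" "S \<subseteq> U \<inter> U'"
    and lip_a: "\<And>x y z w. (x, y) \<in> S \<Longrightarrow> z \<in> I \<Longrightarrow> w \<in> I \<Longrightarrow> \<bar>a x y z - a x y w\<bar> \<le> C * \<bar>z - w\<bar>"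
    and lip_b: "\<And>x y z w. (x, y) \<in> S \<Longrightarrow> z \<in> I \<Longrightarrow> w \<in> I \<Longrightarrow> \<bar>b x y z - b x y w\<bar> \<le> C * \<bar>z - w\<bar>"
    and p0: "p0 \<in> S" "f p0 = g p0" and p: "p \<in> S"
  shows "f p = g p"
proof -
  obtain x0 y0 x1 y1 where eqs: "p0 = (x0, y0)" "p = (x1, y1)"
    by (metis surj_pair)
  define X Y where "X t = x0 + t * (x1 - x0)" and "Y t = y0 + t * (y1 - y0)" for t
  define u where "u t = f (X t, Y t) - g (X t, Y t)" for t
  define da db where
    "da t = a (X t) (Y t) (f (X t, Y t)) - a (X t) (Y t) (g (X t, Y t))" and
    "db t = b (X t) (Y t) (f (X t, Y t)) - b (X t) (Y t) (g (X t, Y t))" for t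
  have inS: "(X t, Y t) \<in> S" if "t \<in> {0..1}" for t
  proof -
    have "(1 - t) *\<^sub>R p0 + t *\<^sub>R p \<in> S"
      using that p p0 S(1) by (intro convexD) auto
    then show ?thesis
      by (simp add: eqs X_def Y_def algebra_simps)
  qed
  have along: "((\<lambda>t. k (X t, Y t)) has_real_derivative
      a (X t) (Y t) (k (X t, Y t)) * (x1 - x0) + b (X t) (Y t) (k (X t, Y t)) * (y1 - y0)) (at t)"
    if "pfaff_solution V I a b W k" "(X t, Y t) \<in> W" for k W t
  proof -
    have "((\<lambda>t. (X t, Y t)) has_derivative (\<lambda>h. (h * (x1 - x0), h * (y1 - y0)))) (at t)"
      unfolding X_def Y_def by (auto intro!: derivative_eq_intros)
    from has_derivative_compose[OF this pfaff_solution_has_derivative[OF that]]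
    show ?thesis
      unfolding has_field_derivative_def
      by (rule has_derivative_eq_rhs) (simp add: fun_eq_iff algebra_simps)
  qed
  have "u 1 = 0"
  proof (rule gronwall_zero)
    fix t :: real assume t: "t \<in> {0..1}"
    have W: "(X t, Y t) \<in> U" "(X t, Y t) \<in> U'"
      using inS[OF t] S(2) by auto
    show "(u has_real_derivative da t * (x1 - x0) + db t * (y1 - y0)) (at t)"
      unfolding u_def using DERIV_diff[OF along[OF f W(1)] along[OF g W(2)]]
      by (simp add: da_def db_def algebra_simps)
    have "f (X t, Y t) \<in> I" "g (X t, Y t) \<in> I"
      using f g W by (auto simp: pfaff_solution_def)
    then have d: "\<bar>da t\<bar> \<le> C * \<bar>u t\<bar>" "\<bar>db t\<bar> \<le> C * \<bar>u t\<bar>"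
      unfolding da_def db_def u_def using lip_a lip_b inS[OF t] by blast+
    have "\<bar>da t * (x1 - x0) + db t * (y1 - y0)\<bar> \<le> \<bar>da t\<bar> * \<bar>x1 - x0\<bar> + \<bar>db t\<bar> * \<bar>y1 - y0\<bar>"
      by (metis abs_mult abs_triangle_ineq)
    also have "\<dots> \<le> (C * \<bar>u t\<bar>) * \<bar>x1 - x0\<bar> + (C * \<bar>u t\<bar>) * \<bar>y1 - y0\<bar>"
      by (intro add_mono mult_right_mono d) auto
    finally show "\<bar>da t * (x1 - x0) + db t * (y1 - y0)\<bar> \<le> (C * (\<bar>x1 - x0\<bar> + \<bar>y1 - y0\<bar>)) * \<bar>u t\<bar>"
      by (simp add: algebra_simps)
  next
    show "u 0 = 0"
      using p0(2) by (simp add: u_def X_def Y_def eqs)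
  qed
  then show ?thesis
    by (simp add: u_def X_def Y_def eqs)
qed

text \<open>If \<open>\<phi>\<close> is a potential of \<open>A dx + B dy\<close> and \<open>h' = F(h)\<close>, then the chain rule gives
  \<open>d(h \<circ> \<phi>) = F(h \<circ> \<phi>) (A dx + B dy)\<close>, so that \<open>h \<circ> \<phi>\<close> solves the system.\<close>
lemma separable_pfaff_local_solution:
  fixes A B \<phi> :: "real \<times> real \<Rightarrow> real"
  assumes W: "open W" "W \<subseteq> V" "p0 \<in> W"
    and \<phi>: "\<And>x y. (x, y) \<in> W \<Longrightarrow> (\<phi> has_derivative (\<lambda>(u, v). A (x, y) * u + B (x, y) * v)) (at (x, y))"
    and I: "open I" and F: "continuous_on I F" and z0: "z0 \<in> I"
  obtains U f where "pfaff_solution V I (\<lambda>x y z. A (x, y) * F z) (\<lambda>x y z. B (x, y) * F z) U f"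
    and "p0 \<in> U" and "f p0 = z0"
proof -
  obtain \<delta> h where \<delta>: "\<delta> > 0" and h0: "h 0 = z0"
    and h: "\<And>t. \<bar>t\<bar> < \<delta> \<Longrightarrow> h t \<in> I \<and> (h has_real_derivative F (h t)) (at t)"
    using autonomous_ode_local_solution[OF I F z0] by metis
  define U where "U = {p \<in> W. \<bar>\<phi> p - \<phi> p0\<bar> < \<delta>}"
  define f where "f p = h (\<phi> p - \<phi> p0)" for p
  have "continuous_on W \<phi>"
    using \<phi> by (auto intro!: continuous_at_imp_continuous_on dest: has_derivative_continuous)
  then have "open (W \<inter> (\<lambda>p. \<phi> p - \<phi> p0) -` ball 0 \<delta>)"
    by (intro continuous_open_preimage W(1) continuous_intros) auto
  moreover have "W \<inter> (\<lambda>p. \<phi> p - \<phi> p0) -` ball 0 \<delta> = U"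
    by (auto simp: U_def)
  ultimately have U: "open U" by simp
  have df: "(f has_derivative (\<lambda>(u, v). A (x, y) * F (f (x, y)) * u + B (x, y) * F (f (x, y)) * v)) (at (x, y))"
    if "(x, y) \<in> U" for x y
  proof -
    have "((\<lambda>p. \<phi> p - \<phi> p0) has_derivative (\<lambda>(u, v). A (x, y) * u + B (x, y) * v)) (at (x, y))"
      using \<phi>[of x y] that by (auto simp: U_def intro!: derivative_eq_intros)
    moreover have "(h has_derivative (*) (F (f (x, y)))) (at (\<phi> (x, y) - \<phi> p0))"
      using h that by (auto simp: U_def f_def has_field_derivative_def)
    ultimately have "(f has_derivative (\<lambda>w. F (f (x, y)) * (case w of (u, v) \<Rightarrow> A (x, y) * u + B (x, y) * v)))
        (at (x, y))"
      unfolding f_def by (rule has_derivative_compose)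
    then show ?thesis
      by (simp add: case_prod_unfold algebra_simps)
  qed
  have "pfaff_solution V I (\<lambda>x y z. A (x, y) * F z) (\<lambda>x y z. B (x, y) * F z) U f"
    unfolding pfaff_solution_def
  proof (intro conjI allI impI)
    show "open U" by (fact U)
    show "U \<subseteq> V" using W by (auto simp: U_def)
    show "f ` U \<subseteq> I" using h by (auto simp: U_def f_def)
    show "f differentiable_on U"
      using df U by (auto simp: differentiable_on_eq_differentiable_at differentiable_def)
    fix x y assume "(x, y) \<in> U"
    from has_derivative_imp_partials(3,4)[OF df[OF this]]
    show "partial_x f (x, y) = A (x, y) * F (f (x, y))" "partial_y f (x, y) = B (x, y) * F (f (x, y))"
      by simp_all
  qed
  moreover have "p0 \<in> U" "f p0 = z0"
    using W \<delta> h0 by (simp_all add: U_def f_def)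
  ultimately show ?thesis by (rule that)
qed

text \<open>On a compact ball the coefficients \<open>A\<close> and \<open>B\<close> are bounded, so the right-hand sides of the
  system inherit a uniform Lipschitz constant from \<open>F\<close>.\<close>
lemma separable_pfaff_locally_unique:
  fixes A B :: "real \<times> real \<Rightarrow> real"
  assumes A: "continuous_on V A" and B: "continuous_on V B" and F: "L-lipschitz_on I F"
    and f: "pfaff_solution V I (\<lambda>x y z. A (x, y) * F z) (\<lambda>x y z. B (x, y) * F z) U f"
    and g: "pfaff_solution V I (\<lambda>x y z. A (x, y) * F z) (\<lambda>x y z. B (x, y) * F z) U' g"
    and p0: "p0 \<in> U" "p0 \<in> U'" "f p0 = g p0"
  shows "\<forall>\<^sub>F p in nhds p0. f p = g p"
proof -
  have U: "open U" "open U'" "U \<subseteq> V"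
    using f g by (auto simp: pfaff_solution_def)
  then obtain r where r: "r > 0" "cball p0 r \<subseteq> U \<inter> U'"
    using p0 by (meson IntI open_Int open_contains_cball_eq)
  define S where "S = cball p0 r"
  have "bounded (A ` S \<union> B ` S)"
    unfolding bounded_Un S_def using U r A B
    by (intro conjI compact_imp_bounded compact_continuous_image compact_cball)
      (auto intro: continuous_on_subset)
  then obtain M where M: "\<And>p. p \<in> S \<Longrightarrow> \<bar>A p\<bar> \<le> M \<and> \<bar>B p\<bar> \<le> M"
    unfolding bounded_iff by (metis UnI1 UnI2 image_eqI real_norm_def)
  \<comment> \<open>\<open>H\<close> stands for a value of \<open>A\<close> or of \<open>B\<close>.\<close>
  have lip: "\<bar>H * F z - H * F w\<bar> \<le> (M * L) * \<bar>z - w\<bar>" if "z \<in> I" "w \<in> I" "\<bar>H\<bar> \<le> M" for H z w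
  proof -
    have "\<bar>H * F z - H * F w\<bar> = \<bar>H\<bar> * \<bar>F z - F w\<bar>"
      by (simp add: abs_mult flip: right_diff_distrib)
    also have "\<dots> \<le> M * (L * \<bar>z - w\<bar>)"
      using that lipschitz_onD[OF F that(1,2)] by (intro mult_mono) (auto simp: dist_real_def)
    finally show ?thesis by (simp add: mult.assoc)
  qed
  have "f p = g p" if "p \<in> S" for p
    by (rule pfaff_solutions_agree[OF f g, of S "M * L" p0])
      (use r p0 that M lip in \<open>auto simp: S_def\<close>)
  then show ?thesis
    unfolding eventually_nhds S_def using r by (intro exI[of _ "ball p0 r"]) auto
qed

theorem theorem1p8:
  fixes V :: "(real \<times> real) set" and I :: "real set"
    and A B :: "real \<times> real \<Rightarrow> real" and F :: "real \<Rightarrow> real"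
  assumes "open V" and "open I" and "is_interval I"
    and "continuous_on V A" and "continuous_on V B" and "continuous_on I F"
    and "\<exists>L. L-lipschitz_on I F"
    and "\<exists>(Ak :: nat \<Rightarrow> real \<times> real \<Rightarrow> real) (Bk :: nat \<Rightarrow> real \<times> real \<Rightarrow> real).
           (\<forall>k. C1_on V (Ak k)) \<and> (\<forall>k. C1_on V (Bk k)) \<and>
           C0_converges V Ak A \<and> C0_converges V Bk B \<and>
           C0_converges V (\<lambda>k p. partial_y (Ak k) p - partial_x (Bk k) p) (\<lambda>p. 0)"
  shows "\<forall>x0 y0 z0. (x0, y0) \<in> V \<and> z0 \<in> I \<longrightarrow>
           uniquely_integrable_at V I (\<lambda>x y z. A (x, y) * F z) (\<lambda>x y z. B (x, y) * F z) x0 y0 z0"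
proof (intro allI impI)
  fix x0 y0 z0 assume "(x0, y0) \<in> V \<and> z0 \<in> I"
  then have p0: "(x0, y0) \<in> V" and z0: "z0 \<in> I" by simp_all
  obtain Ak Bk :: "nat \<Rightarrow> real \<times> real \<Rightarrow> real" where
    k: "\<And>k. C1_on V (Ak k)" "\<And>k. C1_on V (Bk k)"
      "C0_converges V Ak A" "C0_converges V Bk B"
      "C0_converges V (\<lambda>k p. partial_y (Ak k) p - partial_x (Bk k) p) (\<lambda>p. 0)"
    using assms(8) by blast
  obtain L where L: "L-lipschitz_on I F"
    using assms(7) by blast
  obtain \<alpha> \<beta> where box: "(x0, y0) \<in> box \<alpha> \<beta>" "cbox \<alpha> \<beta> \<subseteq> V"
    using open_contains_cbox[of V] assms(1) p0 by metis
  obtain a c b d where eqs: "\<alpha> = (a, c)" "\<beta> = (b, d)"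
    by (metis surj_pair)
  note R = box(2)[unfolded eqs]
  have rect: "integral {a..x} (\<lambda>t. A (t, y)) + integral {c..y} (\<lambda>s. B (a, s)) =
      integral {a..x} (\<lambda>t. A (t, c)) + integral {c..y} (\<lambda>s. B (x, s))"
    if "x \<in> {a..b}" "y \<in> {c..d}" for x y
    by (rule weakly_closed_rectangle[OF k])
      (use that R in \<open>auto simp: cbox_Pair_eq subset_iff\<close>)
  obtain \<phi> where \<phi>: "\<And>x y. (x, y) \<in> box (a, c) (b, d) \<Longrightarrow>
      (\<phi> has_derivative (\<lambda>(u, v). A (x, y) * u + B (x, y) * v)) (at (x, y))"
    using potential_of_closed_form[OF continuous_on_subset[OF assms(4) R]
        continuous_on_subset[OF assms(5) R] rect] by blast
  have "box (a, c) (b, d) \<subseteq> V"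
    using R box_subset_cbox by blast
  then obtain U f where "pfaff_solution V I (\<lambda>x y z. A (x, y) * F z) (\<lambda>x y z. B (x, y) * F z) U f"
    "(x0, y0) \<in> U" "f (x0, y0) = z0"
    using separable_pfaff_local_solution[OF open_box _ _ \<phi> assms(2,6) z0,
        where V = V and ?p0.0 = "(x0, y0)"] box(1)
    unfolding eqs by blast
  moreover have "\<forall>\<^sub>F p in nhds (x0, y0). f p = g p"
    if "pfaff_solution V I (\<lambda>x y z. A (x, y) * F z) (\<lambda>x y z. B (x, y) * F z) U f"
      "(x0, y0) \<in> U" "f (x0, y0) = z0"
      "pfaff_solution V I (\<lambda>x y z. A (x, y) * F z) (\<lambda>x y z. B (x, y) * F z) U' g"
      "(x0, y0) \<in> U'" "g (x0, y0) = z0"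
    for U f U' g
    using that by (intro separable_pfaff_locally_unique[OF assms(4,5) L that(1,4)]) simp_all
  ultimately show "uniquely_integrable_at V I (\<lambda>x y z. A (x, y) * F z) (\<lambda>x y z. B (x, y) * F z) x0 y0 z0"
    unfolding uniquely_integrable_at_def by blast
qed

end
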